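(* Let $X$ be a compact metric space that is not a single point, and let $f:X\to X$ be chain mixing and have Lipschitz constant $c$. Let $D$ be the diameter of $X$. Then for $\delta>0$ sufficiently small and $0<\varepsilon<\delta$: $$m_\varepsilon(\delta,f)\ \ge\ \log_{c}\left(\frac{D(c-1)+2\varepsilon}{2\delta(c-1)+2\varepsilon}\right)\quad\text{if } c>1,$$ and $$m_\varepsilon(\delta,f)\ \ge\ \frac{D-2\delta}{2\varepsilon}\quad\text{if } c=1.$$
   Context: Write $\mathrm{dist}$ for the metric of $X$. The map $f$ has Lipschitz constant $c$ if $\mathrm{dist}(f(x),f(y))\le c\,\mathrm{dist}(x,y)$ for all $x,y\in X$. An $\varepsilon$-chain (for $f$) of length $n\ge1$ from $x$ to $y$ is a sequence $(x=x_0,x_1,\dots,x_n=y)$ with $\mathrm{dist}(f(x_{i-1}),x_i)\le\varepsilon$ for $i=1,\dots,n$. The map $f$ is $\varepsilon$-chain mixing if there is $N>0$ such that for any $x,y\in X$ and any $n\ge N$ there is an $\varepsilon$-chain from $x$ to $y$ of length exactly $n$; $f$ is chain mixing if it is $\varepsilon$-chain mixing for every $\varepsilon>0$. For $0<\varepsilon<\delta$ and $x\in X$, the chain mixing time $m_\varepsilon(x,\delta,f)$ is the smallest positive integer $N$ such that for any $n\ge N$ and any $y\in X$ there is an $\varepsilon$-chain of length exactly $n$ from some point of $B_\delta(x)$ to $y$, where $B_\delta(x)=\{z\in X:\mathrm{dist}(x,z)\le\delta\}$. Set $m_\varepsilon(\delta,f)=\max_{x\in X}m_\varepsilon(x,\delta,f)$.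 *)

theory Defs
  imports "HOL-Analysis.Analysis"
begin

text \<open>
  The metric space is a subset \<open>X\<close> of a type of class \<^class>\<open>metric_space\<close>, and \<open>f\<close> is a
  total function of which only the values on \<open>X\<close> matter.
\<close>

definition eps_chain ::
  "'a::metric_space set \<Rightarrow> ('a \<Rightarrow> 'a) \<Rightarrow> real \<Rightarrow> nat \<Rightarrow> (nat \<Rightarrow> 'a) \<Rightarrow> 'a \<Rightarrow> 'a \<Rightarrow> bool" where
  "eps_chain X f \<epsilon> n s x y \<longleftrightarrow>
     n \<ge> 1 \<and> (\<forall>i\<le>n. s i \<in> X) \<and> s 0 = x \<and> s n = y \<and>
     (\<forall>i\<in>{1..n}. dist (f (s (i - 1))) (s i) \<le> \<epsilon>)"

definition eps_chain_mixing :: "'a::metric_space set \<Rightarrow> ('a \<Rightarrow> 'a) \<Rightarrow> real \<Rightarrow> bool" where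
  "eps_chain_mixing X f \<epsilon> \<longleftrightarrow>
     (\<exists>N>0. \<forall>x\<in>X. \<forall>y\<in>X. \<forall>n\<ge>N. \<exists>s. eps_chain X f \<epsilon> n s x y)"

definition chain_mixing :: "'a::metric_space set \<Rightarrow> ('a \<Rightarrow> 'a) \<Rightarrow> bool" where
  "chain_mixing X f \<longleftrightarrow> (\<forall>\<epsilon>>0. eps_chain_mixing X f \<epsilon>)"

definition chain_mixing_time_at ::
  "'a::metric_space set \<Rightarrow> ('a \<Rightarrow> 'a) \<Rightarrow> real \<Rightarrow> real \<Rightarrow> 'a \<Rightarrow> nat" where
  "chain_mixing_time_at X f \<epsilon> \<delta> x =
     (LEAST N. N > 0 \<and>
        (\<forall>n\<ge>N. \<forall>y\<in>X. \<exists>z\<in>X \<inter> cball x \<delta>. \<exists>s. eps_chain X f \<epsilon> n s z y))"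

text \<open>
  If \<open>f\<close> is chain mixing, the number \<open>N\<close> of \<^const>\<open>eps_chain_mixing\<close> bounds
  \<^const>\<open>chain_mixing_time_at\<close> for all \<open>x \<in> X\<close> at once. So the image below is a finite set of
  natural numbers, even when \<open>X\<close> is infinite, and \<^const>\<open>Max\<close> is the true maximum.
\<close>

definition chain_mixing_time ::
  "'a::metric_space set \<Rightarrow> ('a \<Rightarrow> 'a) \<Rightarrow> real \<Rightarrow> real \<Rightarrow> nat" where
  "chain_mixing_time X f \<epsilon> \<delta> = Max (chain_mixing_time_at X f \<epsilon> \<delta> ` X)"

end

theory Submission
  imports Defs
begin

text \<open>
  Fix \<open>x \<in> X\<close> and follow its true orbit.  Along an \<open>\<epsilon>\<close>-chain that starts within \<open>\<delta>\<close> of \<open>x\<close>, each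
  step multiplies the distance to the orbit by at most \<open>c\<close> and then adds at most \<open>\<epsilon>\<close>, so after \<open>n\<close>
  steps the chain lies within \<open>c^n \<delta> + \<epsilon> (1 + c + \<dots> + c^(n - 1))\<close> of the single point \<open>f^n(x)\<close>
  (lemma \<open>eps_chain_near_orbit\<close>).  If \<open>n\<close> is the chain mixing time at \<open>x\<close>, such chains reach every
  point of \<open>X\<close>, in particular two points at distance \<open>diameter X\<close>.  Hence \<open>diameter X\<close> is at most
  twice this radius (lemma \<open>diameter_le_twice_chain_spread\<close>).  Summing the geometric series and
  solving for \<open>n\<close> gives the two bounds.
\<close>

lemma eps_chain_near_orbit:
  assumes "c-lipschitz_on X f" and "f ` X \<subseteq> X" and "x \<in> X"
    and "eps_chain X f \<epsilon> n s z y" and "dist x z \<le> \<delta>"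
  shows "dist ((f ^^ n) x) y \<le> c ^ n * \<delta> + \<epsilon> * (\<Sum>j<n. c ^ j)"
proof -
  have c0: "0 \<le> c" using assms(1) by (rule lipschitz_on_nonneg)
  have sX: "s i \<in> X" if "i \<le> n" for i
    using assms(4) that by (simp add: eps_chain_def)
  have step: "dist (f (s i)) (s (Suc i)) \<le> \<epsilon>" if "Suc i \<le> n" for i
    using assms(4) that by (auto simp: eps_chain_def dest: bspec[where x = "Suc i"])
  have orbit: "(f ^^ i) x \<in> X" for i
    using assms(2,3) by (induction i) auto
  have "dist ((f ^^ i) x) (s i) \<le> c ^ i * \<delta> + \<epsilon> * (\<Sum>j<i. c ^ j)" if "i \<le> n" for i
    using that
  proof (induction i)
    case 0
    then show ?case using assms(4,5) by (simp add: eps_chain_def)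
  next
    case (Suc i)
    have "dist ((f ^^ Suc i) x) (s (Suc i))
        \<le> dist (f ((f ^^ i) x)) (f (s i)) + dist (f (s i)) (s (Suc i))"
      by (simp add: dist_triangle)
    also have "\<dots> \<le> c * dist ((f ^^ i) x) (s i) + \<epsilon>"
      using lipschitz_onD[OF assms(1) orbit sX] step Suc.prems by (intro add_mono) auto
    also have "\<dots> \<le> c * (c ^ i * \<delta> + \<epsilon> * (\<Sum>j<i. c ^ j)) + \<epsilon>"
      using Suc c0 by (intro add_mono mult_left_mono) auto
    also have "\<dots> = c ^ Suc i * \<delta> + \<epsilon> * (\<Sum>j<Suc i. c ^ j)"
      by (simp only: sum.lessThan_Suc_shift) (simp add: algebra_simps sum_distrib_left)
    finally show ?case .
  qed
  from this[of n] show ?thesis using assms(4) by (simp add: eps_chain_def)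
qed

text \<open>
  The constant \<open>N\<close> from chain mixing works from every starting point, and the ball around \<open>x\<close>
  contains \<open>x\<close>.  This uniformity in \<open>x\<close> makes the set of local mixing times finite, without which
  the maximum would carry no information.
\<close>

lemma chain_mixing_time_reaches:
  assumes "eps_chain_mixing X f \<epsilon>" and "0 \<le> \<delta>" and "x \<in> X"
  obtains m where "m \<le> chain_mixing_time X f \<epsilon> \<delta>"
    and "\<And>y. y \<in> X \<Longrightarrow> \<exists>z\<in>X \<inter> cball x \<delta>. \<exists>s. eps_chain X f \<epsilon> m s z y"
proof -
  define P where "P x N \<longleftrightarrow> N > 0 \<and>
    (\<forall>n\<ge>N. \<forall>y\<in>X. \<exists>z\<in>X \<inter> cball x \<delta>. \<exists>s. eps_chain X f \<epsilon> n s z y)" for x and N :: nat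
  have time_eq: "chain_mixing_time_at X f \<epsilon> \<delta> x = (LEAST N. P x N)" for x
    by (simp add: chain_mixing_time_at_def P_def)
  obtain N where N: "N > 0" "\<forall>x\<in>X. \<forall>y\<in>X. \<forall>n\<ge>N. \<exists>s. eps_chain X f \<epsilon> n s x y"
    using assms(1) by (auto simp: eps_chain_mixing_def)
  have PN: "P x' N" if "x' \<in> X" for x'
    unfolding P_def
  proof (intro conjI allI impI ballI)
    show "N > 0" by (rule N(1))
    fix n y assume "N \<le> n" "y \<in> X"
    then show "\<exists>z\<in>X \<inter> cball x' \<delta>. \<exists>s. eps_chain X f \<epsilon> n s z y"
      using N(2) that assms(2) by (intro bexI[of _ x']) auto
  qed
  have "chain_mixing_time_at X f \<epsilon> \<delta> ` X \<subseteq> {..N}"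
    using PN by (auto simp: time_eq intro: Least_le)
  then have "finite (chain_mixing_time_at X f \<epsilon> \<delta> ` X)"
    by (rule finite_subset) simp
  then have "chain_mixing_time_at X f \<epsilon> \<delta> x \<le> chain_mixing_time X f \<epsilon> \<delta>"
    unfolding chain_mixing_time_def using assms(3) by (intro Max_ge) auto
  moreover have "P x (chain_mixing_time_at X f \<epsilon> \<delta> x)"
    unfolding time_eq using PN[OF assms(3)] by (rule LeastI)
  ultimately show ?thesis
    using that unfolding P_def by blast
qed

lemma diameter_le_twice_chain_spread:
  assumes "compact X" and "x \<in> X" and "f ` X \<subseteq> X" and "c-lipschitz_on X f"
    and reach: "\<And>y. y \<in> X \<Longrightarrow> \<exists>z\<in>X \<inter> cball x \<delta>. \<exists>s. eps_chain X f \<epsilon> n s z y"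
  shows "diameter X \<le> 2 * (c ^ n * \<delta> + \<epsilon> * (\<Sum>j<n. c ^ j))"
proof -
  have near: "dist ((f ^^ n) x) y \<le> c ^ n * \<delta> + \<epsilon> * (\<Sum>j<n. c ^ j)" if "y \<in> X" for y
    using reach[OF that] eps_chain_near_orbit[OF assms(4,3,2)] by (metis IntD2 mem_cball)
  obtain y y' where "y \<in> X" "y' \<in> X" "dist y y' = diameter X"
    using diameter_compact_attained[OF assms(1)] assms(2) by blast
  then have "diameter X \<le> dist ((f ^^ n) x) y + dist ((f ^^ n) x) y'"
    using dist_triangle3[of y y' "(f ^^ n) x"] by simp
  also have "\<dots> \<le> (c ^ n * \<delta> + \<epsilon> * (\<Sum>j<n. c ^ j)) + (c ^ n * \<delta> + \<epsilon> * (\<Sum>j<n. c ^ j))"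
    using near \<open>y \<in> X\<close> \<open>y' \<in> X\<close> by (intro add_mono) auto
  finally show ?thesis by (simp only: mult_2)
qed

theorem proposition23:
  fixes X :: "'a::metric_space set" and f :: "'a \<Rightarrow> 'a" and c :: real
  assumes "compact X" and "X \<noteq> {}" and "\<not> is_singleton X"
    and "f ` X \<subseteq> X"
    and "chain_mixing X f"
    and "c-lipschitz_on X f"
  shows "\<exists>\<delta>\<^sub>0>0. \<forall>\<delta> \<epsilon>. 0 < \<epsilon> \<and> \<epsilon> < \<delta> \<and> \<delta> < \<delta>\<^sub>0 \<longrightarrow>
    (c > 1 \<longrightarrow>
       real (chain_mixing_time X f \<epsilon> \<delta>) \<ge>
         log c ((diameter X * (c - 1) + 2 * \<epsilon>) / (2 * \<delta> * (c - 1) + 2 * \<epsilon>))) \<and>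
    (c = 1 \<longrightarrow>
       real (chain_mixing_time X f \<epsilon> \<delta>) \<ge> (diameter X - 2 * \<delta>) / (2 * \<epsilon>))"
proof (intro exI[of _ 1] conjI allI impI)
  fix \<delta> \<epsilon> :: real
  assume "0 < \<epsilon> \<and> \<epsilon> < \<delta> \<and> \<delta> < 1"
  then have pos: "0 < \<epsilon>" "0 < \<delta>" by auto
  obtain x where x: "x \<in> X" using assms(2) by blast
  have "eps_chain_mixing X f \<epsilon>" using assms(5) pos by (simp add: chain_mixing_def)
  then obtain m where m: "m \<le> chain_mixing_time X f \<epsilon> \<delta>"
    and reach: "\<And>y. y \<in> X \<Longrightarrow> \<exists>z\<in>X \<inter> cball x \<delta>. \<exists>s. eps_chain X f \<epsilon> m s z y"
    using chain_mixing_time_reaches pos(2) x by (metis less_imp_le)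
  have D: "diameter X \<le> 2 * (c ^ m * \<delta> + \<epsilon> * (\<Sum>j<m. c ^ j))"
    by (rule diameter_le_twice_chain_spread[OF assms(1) x assms(4,6) reach])
  show "log c ((diameter X * (c - 1) + 2 * \<epsilon>) / (2 * \<delta> * (c - 1) + 2 * \<epsilon>))
      \<le> real (chain_mixing_time X f \<epsilon> \<delta>)" if c: "1 < c"
  proof -
    have D0: "0 \<le> diameter X"
      using assms(1) by (intro diameter_ge_0 compact_imp_bounded)
    have num: "0 < diameter X * (c - 1) + 2 * \<epsilon>" and den: "0 < 2 * \<delta> * (c - 1) + 2 * \<epsilon>"
      using D0 pos c by (auto intro!: add_nonneg_pos)
    have geometric: "(\<Sum>j<m. c ^ j) * (c - 1) = c ^ m - 1"
      using power_diff_1_eq[of c m] by (simp add: mult.commute)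
    have "diameter X * (c - 1) \<le> 2 * (c ^ m * \<delta> + \<epsilon> * (\<Sum>j<m. c ^ j)) * (c - 1)"
      using D c by (intro mult_right_mono) auto
    also have "\<dots> = 2 * c ^ m * \<delta> * (c - 1) + 2 * \<epsilon> * ((\<Sum>j<m. c ^ j) * (c - 1))"
      by (simp add: algebra_simps)
    also have "\<dots> = c ^ m * (2 * \<delta> * (c - 1) + 2 * \<epsilon>) - 2 * \<epsilon>"
      unfolding geometric by (simp add: algebra_simps)
    finally have "(diameter X * (c - 1) + 2 * \<epsilon>) / (2 * \<delta> * (c - 1) + 2 * \<epsilon>) \<le> c ^ m"
      using den by (simp add: pos_divide_le_eq)
    then have "log c ((diameter X * (c - 1) + 2 * \<epsilon>) / (2 * \<delta> * (c - 1) + 2 * \<epsilon>)) \<le> log c (c ^ m)"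
      using c num den by (subst log_le_cancel_iff) auto
    also have "\<dots> = real m" using c by (simp add: log_nat_power)
    finally show ?thesis using m by linarith
  qed
  show "(diameter X - 2 * \<delta>) / (2 * \<epsilon>) \<le> real (chain_mixing_time X f \<epsilon> \<delta>)" if c: "c = 1"
  proof -
    have "(diameter X - 2 * \<delta>) / (2 * \<epsilon>) \<le> real m"
      using D pos by (simp add: c pos_divide_le_eq algebra_simps)
    then show ?thesis using m by linarith
  qed
qed simp

end
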